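(* Let $n\geq 1$ be an integer. Every sock ordering with $n$ colors is $\lceil\log_2(n)\rceil$-foot-sortable. Moreover, there exist sock orderings with $n$ colors that are not $(\lceil\log_2(n)\rceil-1)$-foot-sortable.
   Context: A sock ordering of length $N$ is a finite line (sequence) of $N$ socks, each having a color, where two sequences are considered the same sock ordering if one is obtained from the other by (injectively) renaming colors. Equivalently, a sock ordering of length $N$ is a set partition of $[N]=\{1,\ldots,N\}$, where $i$ and $j$ lie in the same block if and only if the socks in positions $i$ and $j$ have the same color. A sock ordering with $n$ colors is one in which exactly $n$ different colors appear (a set partition with $n$ blocks). A sock ordering is sorted if all socks of each color appear consecutively. $t$-foot-sorting algorithm (non-deterministic), for $t\ge1$: there are $t$ feet in a line, numbered $f_1,\ldots,f_t$ from right to left, all initially empty. Initially the whole sock ordering is a line to the right of the feet, and there are no socks to the left of the feet. At each point in time one performs one of the following operations: (1) take the leftmost sock that lies to the right of the feet and put it onto foot $f_1$, over all socks already on $f_1$; (2) for some $1\le i\le t-1$, remove the outermost (most recently put on) sock from $f_i$ and put it onto $f_{i+1}$, over all socks already on $f_{i+1}$; (3) remove the outermost sock from $f_t$ and place it to the left of the feet, to the right of all other socks that are to the left of the feet. The process ends when all socks are to the left of the feet; the line of socks on the left is the resulting sock ordering. (Thus the feet are $t$ stacks in series; equivalently, one applies the one-foot algorithm $t$ times in succession.) A sock ordering is $t$-foot-sortable if some choice of operations transforms it into a sorted sock ordering; it is $0$-foot-sortable if and only if it is sorted. By convention, no sock ordering is $t$-foot-sortable for $t<0$. *)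

theory Defs
  imports Complex_Main
begin

definition renaming :: "nat list \<Rightarrow> nat list \<Rightarrow> bool" where
  "renaming xs ys \<longleftrightarrow> (\<exists>f. inj_on f (set xs) \<and> ys = map f xs)"

lemma renaming_equivp: "equivp renaming"
proof (rule equivpI)
  show "reflp renaming"
    by (rule reflpI) (auto simp: renaming_def intro!: exI[of _ id])
  show "symp renaming"
  proof (rule sympI)
    fix xs ys assume "renaming xs ys"
    then obtain f where f: "inj_on f (set xs)" "ys = map f xs"
      by (auto simp: renaming_def)
    have "inj_on (inv_into (set xs) f) (set ys)"
      using f by (simp add: inj_on_inv_into)
    moreover have "map (inv_into (set xs) f) ys = xs"
      using f by (simp add: map_idI)
    ultimately show "renaming ys xs"
      unfolding renaming_def by metis
  qed
  show "transp renaming"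
  proof (rule transpI)
    fix xs ys zs assume "renaming xs ys" "renaming ys zs"
    then obtain f g where "inj_on f (set xs)" "ys = map f xs"
      "inj_on g (set ys)" "zs = map g ys"
      by (auto simp: renaming_def)
    then show "renaming xs zs"
      unfolding renaming_def by (intro exI[of _ "g \<circ> f"]) (auto intro: comp_inj_on)
  qed
qed

text \<open>A sock ordering is a sequence of colors (named by natural numbers), up to an injective
  renaming of the colors.\<close>

quotient_type sock_ordering = "nat list" / renaming
  by (rule renaming_equivp)

lift_definition num_colors :: "sock_ordering \<Rightarrow> nat" is "\<lambda>xs. card (set xs)"
  by (auto simp: renaming_def card_image)

definition color_sorted :: "nat list \<Rightarrow> bool" where
  "color_sorted xs \<longleftrightarrow>
    (\<forall>i j k. i < j \<and> j < k \<and> k < length xs \<and> xs ! i = xs ! k \<longrightarrow> xs ! j = xs ! i)"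

text \<open>A configuration \<open>(L, F, R)\<close> consists of the line \<open>L\<close> of socks to the left of the feet, the
  contents \<open>F i\<close> of foot number \<open>i\<close> with the outermost sock first, and the line \<open>R\<close> of socks to
  the right of the feet. Both lines are read from left to right. With \<open>t\<close> feet, only the values
  \<open>F 1, \<dots>, F t\<close> are meaningful.\<close>

type_synonym config = "nat list \<times> (nat \<Rightarrow> nat list) \<times> nat list"

inductive foot_step :: "nat \<Rightarrow> config \<Rightarrow> config \<Rightarrow> bool" for t :: nat where
  put_on: "foot_step t (L, F, x # R) (L, F(1 := x # F 1), R)"
| move: "1 \<le> i \<Longrightarrow> i < t \<Longrightarrow> F i = x # S \<Longrightarrow>
    foot_step t (L, F, R) (L, F(i := S, Suc i := x # F (Suc i)), R)"
| take_off: "F t = x # S \<Longrightarrow> foot_step t (L, F, R) (L @ [x], F(t := S), R)"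

definition foot_result :: "nat \<Rightarrow> nat list \<Rightarrow> nat list \<Rightarrow> bool" where
  "foot_result t xs ys \<longleftrightarrow> (foot_step t)\<^sup>*\<^sup>* ([], \<lambda>_. [], xs) (ys, \<lambda>_. [], [])"

text \<open>The algorithm is defined only for at least one foot; the cases \<open>t = 0\<close> and \<open>t < 0\<close> are
  conventions.\<close>

definition word_sortable :: "int \<Rightarrow> nat list \<Rightarrow> bool" where
  "word_sortable t xs \<longleftrightarrow>
    (if t < 0 then False
     else if t = 0 then color_sorted xs
     else (\<exists>ys. foot_result (nat t) xs ys \<and> color_sorted ys))"

lemma color_sorted_map:
  assumes "color_sorted xs" "inj_on f (set xs)"
  shows "color_sorted (map f xs)"
  unfolding color_sorted_def
proof (intro allI impI)
  fix i j k
  assume a: "i < j \<and> j < k \<and> k < length (map f xs) \<and> map f xs ! i = map f xs ! k"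
  then have "xs ! i = xs ! k"
    using inj_onD[OF assms(2), of "xs ! i" "xs ! k"] by auto
  then have "xs ! j = xs ! i"
    using a assms(1) unfolding color_sorted_def length_map by blast
  then show "map f xs ! j = map f xs ! i"
    using a by auto
qed

fun map_config :: "(nat \<Rightarrow> nat) \<Rightarrow> config \<Rightarrow> config" where
  "map_config f (L, F, R) = (map f L, \<lambda>i. map f (F i), map f R)"

fun socks :: "config \<Rightarrow> nat set" where
  "socks (L, F, R) = set L \<union> (\<Union>i. set (F i)) \<union> set R"

lemma foot_step_map:
  assumes "foot_step t c d"
  shows "foot_step t (map_config f c) (map_config f d)"
  using assms
proof cases
  case (put_on L F x R)
  have "(\<lambda>i. map f ((F(1 := x # F 1)) i)) = (\<lambda>i. map f (F i))(1 := f x # map f (F 1))"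
    by auto
  then show ?thesis
    using put_on foot_step.put_on[of t "map f L" "\<lambda>i. map f (F i)" "f x" "map f R"] by simp
next
  case (move i F x S L R)
  have "(\<lambda>j. map f ((F(i := S, Suc i := x # F (Suc i))) j)) =
      (\<lambda>j. map f (F j))(i := map f S, Suc i := f x # map f (F (Suc i)))"
    by auto
  then show ?thesis
    using move foot_step.move[of i t "\<lambda>i. map f (F i)" "f x" "map f S" "map f L" "map f R"] by simp
next
  case (take_off F x S L R)
  have "(\<lambda>j. map f ((F(t := S)) j)) = (\<lambda>j. map f (F j))(t := map f S)"
    by auto
  then show ?thesis
    using take_off foot_step.take_off[of "\<lambda>i. map f (F i)" t "f x" "map f S" "map f L" "map f R"]
    by simp
qed

lemma foot_step_socks:
  assumes "foot_step t c d"
  shows "socks d \<subseteq> socks c"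
  using assms
proof cases
  case (put_on L F x R)
  then show ?thesis by (auto split: if_splits)
next
  case (move i F x S L R)
  have "set (F i) \<subseteq> (\<Union>j. set (F j))" by auto
  then have "insert x (set S) \<subseteq> (\<Union>j. set (F j))" using move by simp
  then show ?thesis using move by (auto split: if_splits)
next
  case (take_off F x S L R)
  have "set (F t) \<subseteq> (\<Union>j. set (F j))" by auto
  then have "insert x (set S) \<subseteq> (\<Union>j. set (F j))" using take_off by simp
  then show ?thesis using take_off by (auto split: if_splits)
qed

lemma foot_result_map:
  assumes "foot_result t xs ys"
  shows "foot_result t (map f xs) (map f ys)" "set ys \<subseteq> set xs"
proof -
  have "(foot_step t)\<^sup>*\<^sup>* (map_config f c) (map_config f d) \<and> socks d \<subseteq> socks c"
    if "(foot_step t)\<^sup>*\<^sup>* c d" for c d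
    using that
  proof induction
    case base
    then show ?case by simp
  next
    case (step d e)
    then show ?case
      using foot_step_map[of t d e f] foot_step_socks[of t d e]
      by (meson order_trans rtranclp.rtrancl_into_rtrancl)
  qed
  from this[OF assms[unfolded foot_result_def]]
  show "foot_result t (map f xs) (map f ys)" "set ys \<subseteq> set xs"
    by (auto simp: foot_result_def)
qed

lemma word_sortable_map:
  assumes "word_sortable t xs" "inj_on f (set xs)"
  shows "word_sortable t (map f xs)"
proof -
  have "\<exists>zs. foot_result (nat t) (map f xs) zs \<and> color_sorted zs"
    if ys: "foot_result (nat t) xs ys" "color_sorted ys" for ys
    using foot_result_map[OF ys(1)] color_sorted_map[OF ys(2)] assms(2)
    by (blast intro: inj_on_subset)
  then show ?thesis
    using assms color_sorted_map by (auto simp: word_sortable_def split: if_splits)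
qed

lemma word_sortable_renaming: "renaming xs ys \<Longrightarrow> word_sortable t xs \<Longrightarrow> word_sortable t ys"
  by (auto simp: renaming_def word_sortable_map)

lift_definition foot_sortable :: "int \<Rightarrow> sock_ordering \<Rightarrow> bool" is word_sortable
  using equivp_symp[OF renaming_equivp] word_sortable_renaming by blast

end

theory Submission
  imports Defs "HOL-Library.Sublist"
begin

text \<open>
  Upper bound. One foot can separate the socks into two classes: the socks of the first class
  walk straight through, those of the second wait on the foot and come out at the end, reversed
  (\<open>split_pass\<close>). Give the at most \<open>2 ^ t\<close> colors distinct keys below \<open>2 ^ t\<close> and forget the last
  binary digit of the keys. By induction \<open>t - 1\<close> feet sort the socks by these coarser keys. Now each
  parity class on its own is sorted, because within it the coarse key determines the key, and a
  reversed sorted word is sorted. So splitting by parity with the last foot sorts by the full keys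
  (\<open>foot_sort_by_key\<close>).

  Lower bound. A word is called \<open>M\<close>-rich for a color set \<open>A\<close> if it contains \<open>M\<close> groups of socks, one
  group entirely before the next, each group containing all colors of \<open>A\<close>. A \<open>2\<close>-rich word for two
  colors is not sorted. The claim is that a single stack can at most halve the set of colors for
  which a word is very rich (\<open>stack_order_half_rich\<close>); hence, after \<open>t\<close> stacks, a sufficiently rich
  word on more than \<open>2 ^ t\<close> colors is still \<open>2\<close>-rich for at least two colors, whatever the choices
  were.

  To see the claim, consider a group and some later moment. Either at least half of the colors of
  the group are still held in the stack, or at least half of them have been flushed to the output.
  Cut the input into many chunks. If, for every chunk, half of the colors of its first group have been
  flushed by its end, then the chunks put their flushed colors on the output one after the other,
  and the pigeonhole principle yields many chunks with the same flushed colors. Otherwise there is a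
  chunk whose first group remains held, in half of its colors, up to the end of the chunk, and the
  whole search is repeated inside this chunk. Iterating, one reaches a moment at which many groups
  are held simultaneously, each in half of its colors. Again many of them agree on these colors, and since a stack reverses what it holds,
  these groups come out group by group, in reversed order.

  Feet in series are successive stacks (\<open>foot_result_stack_runs\<close>). To speak about individual socks,
  the feet are run on distinct identifiers whose colors are looked up afterwards; this loses no
  runs (\<open>foot_result_lift\<close>).
\<close>

section \<open>Color-sorted words\<close>

text \<open>The forbidden pattern, phrased with subsequences, makes it evident that deleting socks keeps a
  word sorted.\<close>

lemma color_sortedI_subseq:
  assumes "\<And>x y. subseq [x, y, x] w \<Longrightarrow> x = y"
  shows "color_sorted w"
  unfolding color_sorted_def
proof (intro allI impI)
  fix i j k
  assume a: "i < j \<and> j < k \<and> k < length w \<and> w ! i = w ! k"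
  have "w ! k \<in> set (drop (Suc j) w)"
    using a by (auto simp: in_set_conv_nth intro!: exI[of _ "k - Suc j"])
  then have "subseq [w ! j, w ! k] (drop j w)"
    using a Cons_nth_drop_Suc[of j w, symmetric] by (simp add: subseq_singleton_left)
  moreover have "subseq (drop j w) (drop (Suc i) w)"
    using a suffix_drop[of "j - Suc i" "drop (Suc i) w"] by (simp add: suffix_imp_subseq)
  ultimately have "subseq [w ! j, w ! k] (drop (Suc i) w)"
    by (rule subseq_order.trans)
  then have "subseq [w ! i, w ! j, w ! k] (drop i w)"
    using a Cons_nth_drop_Suc[of i w, symmetric] by simp
  then have "subseq [w ! i, w ! j, w ! k] w"
    using suffix_drop[of i w] by (meson subseq_order.trans suffix_imp_subseq)
  then show "w ! j = w ! i"
    using assms[of "w ! i" "w ! j"] a by auto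
qed

lemma color_sorted_subseqD:
  assumes "color_sorted w" "subseq [x, y, x] w"
  shows "x = y"
proof -
  obtain u1 v1 where 1: "w = u1 @ x # v1" "subseq [y, x] v1"
    using list_emb_ConsD[OF assms(2)] by blast
  obtain u2 v2 where 2: "v1 = u2 @ y # v2" "subseq [x] v2"
    using list_emb_ConsD[OF 1(2)] by blast
  obtain u3 v3 where 3: "v2 = u3 @ x # v3"
    using list_emb_ConsD[OF 2(2)] by blast
  have w: "w = u1 @ x # u2 @ y # u3 @ x # v3"
    using 1 2 3 by simp
  let ?j = "Suc (length u1 + length u2)"
  let ?k = "Suc (Suc (length u1 + length u2 + length u3))"
  have "w ! length u1 = x" "w ! ?j = y" "w ! ?k = x" "?k < length w"
    unfolding w by (auto simp: nth_append)
  then show ?thesis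
    using assms(1)[unfolded color_sorted_def, rule_format, of "length u1" ?j ?k] by simp
qed

lemma color_sorted_subseq: "color_sorted w \<Longrightarrow> subseq v w \<Longrightarrow> color_sorted v"
  by (meson color_sortedI_subseq color_sorted_subseqD subseq_order.trans)

lemma color_sorted_rev:
  assumes "color_sorted w"
  shows "color_sorted (rev w)"
  unfolding color_sorted_def
proof (intro allI impI)
  fix i j k
  assume a: "i < j \<and> j < k \<and> k < length (rev w) \<and> rev w ! i = rev w ! k"
  let ?r = "\<lambda>i. length w - Suc i"
  have "?r k < ?r j \<and> ?r j < ?r i \<and> ?r i < length w \<and> w ! ?r k = w ! ?r i"
    using a by (auto simp: rev_nth)
  then have "w ! ?r j = w ! ?r k"
    using assms unfolding color_sorted_def by blast
  then show "rev w ! j = rev w ! i"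
    using a by (simp add: rev_nth)
qed

lemma color_sorted_append:
  assumes "color_sorted u" "color_sorted v" "set u \<inter> set v = {}"
  shows "color_sorted (u @ v)"
  unfolding color_sorted_def
proof (intro allI impI)
  fix i j k
  assume a: "i < j \<and> j < k \<and> k < length (u @ v) \<and> (u @ v) ! i = (u @ v) ! k"
  consider "k < length u" | "i < length u" "length u \<le> k" | "length u \<le> i" by linarith
  then show "(u @ v) ! j = (u @ v) ! i"
  proof cases
    case 1
    then have "i < length u" "j < length u" using a by auto
    with 1 show ?thesis
      using a assms(1)[unfolded color_sorted_def, rule_format, of i j k] by (auto simp: nth_append)
  next
    case 2
    then have "u ! i = v ! (k - length u)" "k - length u < length v"
      using a by (auto simp: nth_append)
    then have "u ! i \<in> set u \<inter> set v"
      using 2(1) by (metis IntI nth_mem)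
    then show ?thesis using assms(3) by blast
  next
    case 3
    let ?l = "length u"
    have "i - ?l < j - ?l \<and> j - ?l < k - ?l \<and> k - ?l < length v \<and> v ! (i - ?l) = v ! (k - ?l)"
      using 3 a by (auto simp: nth_append)
    then have "v ! (j - ?l) = v ! (i - ?l)"
      using assms(2) unfolding color_sorted_def by blast
    then show ?thesis
      using 3 a by (simp add: nth_append)
  qed
qed

section \<open>Sorting by binary splitting\<close>

text \<open>The pass that is used for sorting: a sock satisfying \<open>P\<close> leaves the foot at once, every other
  sock stays until the end.\<close>

definition split_pass :: "(nat \<Rightarrow> bool) \<Rightarrow> nat list \<Rightarrow> nat list" where
  "split_pass P xs = filter P xs @ rev (filter (\<lambda>x. \<not> P x) xs)"

lemma empty_feet_upd: "(\<lambda>_. [])(t := []) = (\<lambda>_. [])"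
  by auto

lemma foot_steps_empty_last:
  "F t = S \<Longrightarrow> (foot_step t)\<^sup>*\<^sup>* (L, F, R) (L @ S, F(t := []), R)"
proof (induction S arbitrary: L F)
  case Nil
  then have "F(t := []) = F" by auto
  then show ?case by simp
next
  case (Cons x S)
  have "foot_step t (L, F, R) (L @ [x], F(t := S), R)"
    using Cons.prems by (rule foot_step.take_off)
  also have "(foot_step t)\<^sup>*\<^sup>* (L @ [x], F(t := S), R) ((L @ [x]) @ S, (F(t := S))(t := []), R)"
    by (rule Cons.IH) simp
  finally (converse_rtranclp_into_rtranclp)
  have "(foot_step t)\<^sup>*\<^sup>* (L, F, R) (L @ x # S, F(t := []), R)"
    by (simp del: fun_upd_apply)
  then show ?case .
qed

lemma foot_result_split_pass_1: "foot_result 1 xs (split_pass P xs)"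
proof -
  have "(foot_step 1)\<^sup>*\<^sup>* (L, (\<lambda>_. [])(1 := S), xs)
      (L @ filter P xs, (\<lambda>_. [])(1 := rev (filter (\<lambda>x. \<not> P x) xs) @ S), [])" for L S
  proof (induction xs arbitrary: L S)
    case Nil
    then show ?case by simp
  next
    case (Cons x xs)
    have put: "foot_step 1 (L, (\<lambda>_. [])(1 := S), x # xs) (L, (\<lambda>_. [])(1 := x # S), xs)"
      using foot_step.put_on[of 1 L "(\<lambda>_. [])(1 := S)" x xs] by simp
    show ?case
    proof (cases "P x")
      case True
      have "foot_step 1 (L, (\<lambda>_. [])(1 := x # S), xs) (L @ [x], (\<lambda>_. [])(1 := S), xs)"
        using foot_step.take_off[of "(\<lambda>_. [])(1 := x # S)" 1 x S L xs] by simp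
      with put Cons.IH[of "L @ [x]" S] True show ?thesis
        by (auto simp: fun_upd_def intro: converse_rtranclp_into_rtranclp)
    next
      case False
      with put Cons.IH[of L "x # S"] show ?thesis
        by (auto simp: fun_upd_def intro: converse_rtranclp_into_rtranclp)
    qed
  qed
  from this[of "[]" "[]"]
  have "(foot_step 1)\<^sup>*\<^sup>* ([], \<lambda>_. [], xs)
      (filter P xs, (\<lambda>_. [])(1 := rev (filter (\<lambda>x. \<not> P x) xs)), [])"
    by (simp add: fun_upd_def)
  also have "(foot_step 1)\<^sup>*\<^sup>* \<dots> (split_pass P xs, \<lambda>_. [], [])"
    using foot_steps_empty_last[of "(\<lambda>_. [])(1 := rev (filter (\<lambda>x. \<not> P x) xs))" 1 _ "filter P xs" "[]", OF refl]
    by (simp add: split_pass_def empty_feet_upd)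
  finally show ?thesis unfolding foot_result_def .
qed

text \<open>The additional foot is operated online: whenever foot \<open>t\<close> releases a sock, the sock is moved on
  to foot \<open>t + 1\<close> and taken off at once if it satisfies \<open>P\<close>. So a configuration of \<open>t\<close> feet with
  output \<open>L\<close> corresponds to the configuration in which \<open>L\<close> has been divided between the final
  output and the new foot.\<close>

lemma foot_result_Suc_split_pass:
  assumes "1 \<le> t" "foot_result t xs ys"
  shows "foot_result (Suc t) xs (split_pass P ys)"
proof -
  let ?N = "\<lambda>x. \<not> P x"
  define sim :: "config \<Rightarrow> config" where
    "sim = (\<lambda>(L, F, R). (filter P L, F(Suc t := rev (filter ?N L)), R))"
  have step: "(foot_step (Suc t))\<^sup>*\<^sup>* (sim c) (sim d)" if "foot_step t c d" for c d
    using that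
  proof cases
    case (put_on L F x R)
    have "foot_step (Suc t) (sim c) (sim d)"
      using put_on foot_step.put_on[of "Suc t" "filter P L" "F(Suc t := rev (filter ?N L))" x R]
        \<open>1 \<le> t\<close> by (simp add: sim_def fun_upd_twist)
    then show ?thesis by blast
  next
    case (move i F x S L R)
    have "foot_step (Suc t) (sim c) (sim d)"
      using move foot_step.move[of i "Suc t" "F(Suc t := rev (filter ?N L))" x S "filter P L" R]
      by (simp add: sim_def fun_upd_twist)
    then show ?thesis by blast
  next
    case (take_off F x S L R)
    let ?F = "F(Suc t := rev (filter ?N L))"
    let ?G = "F(t := S, Suc t := x # rev (filter ?N L))"
    have move: "foot_step (Suc t) (sim c) (filter P L, ?G, R)"
      using take_off foot_step.move[of t "Suc t" ?F x S "filter P L" R] \<open>1 \<le> t\<close>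
      by (simp add: sim_def fun_upd_twist)
    show ?thesis
    proof (cases "P x")
      case True
      have "foot_step (Suc t) (filter P L, ?G, R) (sim d)"
        using foot_step.take_off[of ?G "Suc t" x "rev (filter ?N L)" "filter P L" R] take_off True
        by (simp add: sim_def)
      with move show ?thesis by (meson r_into_rtranclp rtranclp.rtrancl_into_rtrancl)
    next
      case False
      then have "sim d = (filter P L, ?G, R)"
        using take_off by (simp add: sim_def)
      with move show ?thesis by simp
    qed
  qed
  have "(foot_step (Suc t))\<^sup>*\<^sup>* (sim c) (sim d)" if "(foot_step t)\<^sup>*\<^sup>* c d" for c d
    using that by induction (auto dest: step intro: rtranclp_trans)
  from this[OF assms(2)[unfolded foot_result_def]]
  have "(foot_step (Suc t))\<^sup>*\<^sup>* ([], \<lambda>_. [], xs)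
      (filter P ys, (\<lambda>_. [])(Suc t := rev (filter ?N ys)), [])"
    by (simp add: sim_def fun_upd_def cong: if_cong)
  also have "(foot_step (Suc t))\<^sup>*\<^sup>* \<dots> (split_pass P ys, \<lambda>_. [], [])"
    using foot_steps_empty_last[of "(\<lambda>_. [])(Suc t := rev (filter ?N ys))" "Suc t" _ "filter P ys" "[]", OF refl]
    by (simp add: split_pass_def empty_feet_upd)
  finally show ?thesis unfolding foot_result_def .
qed

text \<open>This is the step of a radix sort. Only the contiguity of the blocks counts, not their order, and
  so the reversal of the odd class does no harm.\<close>

lemma color_sorted_split_pass:
  fixes g :: "nat \<Rightarrow> nat"
  assumes "color_sorted (map (\<lambda>x. g x div 2) ys)"
  shows "color_sorted (map g (split_pass (\<lambda>x. even (g x)) ys))"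
proof -
  let ?h = "\<lambda>x. g x div 2"
  have part: "color_sorted (map g zs)"
    if zs: "subseq zs ys" "\<And>x. x \<in> set zs \<Longrightarrow> g x mod 2 = b" for zs b
  proof -
    have "color_sorted (map ?h zs)"
      using assms color_sorted_subseq subseq_map zs(1) by blast
    then have "color_sorted (map (\<lambda>x. 2 * x + b) (map ?h zs))"
      by (rule color_sorted_map) (auto intro: inj_onI)
    moreover have "map (\<lambda>x. 2 * x + b) (map ?h zs) = map g zs"
      using zs(2) by (auto, metis mult_div_mod_eq)
    ultimately show ?thesis by (simp only:)
  qed
  have "color_sorted (map g (filter (\<lambda>x. even (g x)) ys))"
    by (rule part[where b = 0]) auto
  moreover have "color_sorted (rev (map g (filter (\<lambda>x. odd (g x)) ys)))"
    by (rule color_sorted_rev, rule part[where b = 1]) (auto simp: odd_iff_mod_2_eq_one)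
  ultimately show ?thesis
    unfolding split_pass_def map_append rev_map[symmetric]
    by (rule color_sorted_append) auto
qed

text \<open>Sorting by an arbitrary key instead of by color is what lets the induction drop a binary digit:
  socks of different colors then share a key.\<close>

lemma foot_sort_by_key:
  fixes g :: "nat \<Rightarrow> nat"
  assumes "1 \<le> t" "\<And>x. x \<in> set xs \<Longrightarrow> g x < 2 ^ t"
  shows "\<exists>ys. foot_result t xs ys \<and> color_sorted (map g ys)"
  using assms
proof (induction t arbitrary: g rule: nat_induct_at_least)
  case base
  have "map (\<lambda>x. g x div 2) xs = map (\<lambda>_. 0) xs"
    using base by (auto simp: div_eq_0_iff)
  then have "color_sorted (map (\<lambda>x. g x div 2) xs)"
    by (simp add: color_sorted_def)
  then show ?case
    using foot_result_split_pass_1 color_sorted_split_pass by blast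
next
  case (Suc t)
  have "\<And>x. x \<in> set xs \<Longrightarrow> g x div 2 < 2 ^ t"
    using Suc.prems by (simp add: less_mult_imp_div_less mult.commute)
  then obtain ys where "foot_result t xs ys" "color_sorted (map (\<lambda>x. g x div 2) ys)"
    using Suc.IH[of "\<lambda>x. g x div 2"] by blast
  then show ?case
    using foot_result_Suc_split_pass[OF Suc.hyps(1)] color_sorted_split_pass by blast
qed

lemma foot_sort_few_colors:
  assumes "1 \<le> t" "card (set xs) \<le> 2 ^ t"
  shows "\<exists>ys. foot_result t xs ys \<and> color_sorted ys"
proof -
  obtain g where g: "bij_betw g (set xs) {0..<card (set xs)}"
    using ex_bij_betw_finite_nat by blast
  then have "\<And>x. x \<in> set xs \<Longrightarrow> g x < 2 ^ t"
    using assms(2) by (fastforce dest: bij_betwE)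
  then obtain ys where ys: "foot_result t xs ys" "color_sorted (map g ys)"
    using foot_sort_by_key[OF assms(1)] by blast
  let ?g' = "inv_into (set xs) g"
  have sub: "set ys \<subseteq> set xs"
    using foot_result_map(2)[OF ys(1)] .
  then have "inj_on ?g' (set (map g ys))"
    by (auto intro!: inj_on_inv_into)
  with ys(2) have "color_sorted (map ?g' (map g ys))"
    by (rule color_sorted_map)
  moreover have "map ?g' (map g ys) = ys"
    using sub g by (auto intro!: map_idI simp: bij_betw_def)
  ultimately show ?thesis using ys(1) by auto
qed

section \<open>Feet in series as successive passes through one stack\<close>

text \<open>\<open>stack_run w L S\<close> describes a stack that has received \<open>w\<close>, released \<open>L\<close> and still holds \<open>S\<close>, top
  element first. A complete pass ends with \<open>S = []\<close>.\<close>

inductive stack_run :: "'a list \<Rightarrow> 'a list \<Rightarrow> 'a list \<Rightarrow> bool" where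
  start: "stack_run [] [] []"
| push: "stack_run w L S \<Longrightarrow> stack_run (w @ [x]) L (x # S)"
| pop: "stack_run w L (x # S) \<Longrightarrow> stack_run w (L @ [x]) S"

lemma foot_result_1_stack_run:
  assumes "foot_result 1 xs ys"
  shows "stack_run xs ys []"
proof -
  have "\<exists>M. xs = M @ R \<and> stack_run M L (F 1)"
    if "(foot_step 1)\<^sup>*\<^sup>* ([], \<lambda>_. [], xs) (L, F, R)" for L F R
    using that
  proof (induction "(L, F, R)" arbitrary: L F R rule: rtranclp_induct)
    case base
    then show ?case by (auto intro: stack_run.start)
  next
    case (step c)
    from step(2) show ?case
    proof cases
      case (put_on F' x)
      with step(3)[of L F' "x # R"] obtain M where "xs = M @ x # R" "stack_run M L (F' 1)" by auto
      then show ?thesis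
        using put_on by (intro exI[of _ "M @ [x]"]) (auto intro: stack_run.push)
    next
      case (move i)
      then show ?thesis by simp
    next
      case (take_off F' x S L')
      with step(3)[of L' F' R] show ?thesis
        by (auto intro: stack_run.pop)
    qed
  qed
  then show ?thesis
    using assms unfolding foot_result_def by force
qed

text \<open>The last foot is split off: reading the move onto foot \<open>t + 1\<close> as taking a sock off the feet turns a
  run of \<open>t + 1\<close> feet into a run of \<open>t\<close> feet whose output so far, \<open>M\<close>, is what the last foot
  has received.\<close>

lemma foot_result_Suc_stack_run:
  assumes "1 \<le> t" "foot_result (Suc t) xs ys"
  shows "\<exists>zs. foot_result t xs zs \<and> stack_run zs ys []"
proof -
  let ?init = "([], \<lambda>_. [], xs) :: config"
  have "\<exists>M. (foot_step t)\<^sup>*\<^sup>* ?init (M, F(Suc t := []), R) \<and> stack_run M L (F (Suc t))"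
    if "(foot_step (Suc t))\<^sup>*\<^sup>* ?init (L, F, R)" for L F R
    using that
  proof (induction "(L, F, R)" arbitrary: L F R rule: rtranclp_induct)
    case base
    then show ?case by (auto intro!: exI[of _ "[]"] stack_run.start simp: fun_upd_def)
  next
    case (step c)
    from step(2) show ?case
    proof cases
      case (put_on F' x)
      then obtain M where M: "(foot_step t)\<^sup>*\<^sup>* ?init (M, F'(Suc t := []), x # R)"
        "stack_run M L (F' (Suc t))"
        using step(3) by blast
      have "foot_step t (M, F'(Suc t := []), x # R) (M, F(Suc t := []), R)"
        using put_on \<open>1 \<le> t\<close> foot_step.put_on[of t M "F'(Suc t := [])" x R]
        by (simp add: fun_upd_twist)
      then show ?thesis
        using M put_on \<open>1 \<le> t\<close> by (auto intro!: exI[of _ M] intro: rtranclp.rtrancl_into_rtrancl)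
    next
      case (move i F' x S)
      then obtain M where M: "(foot_step t)\<^sup>*\<^sup>* ?init (M, F'(Suc t := []), R)"
        "stack_run M L (F' (Suc t))"
        using step(3) by blast
      show ?thesis
      proof (cases "i = t")
        case True
        have "foot_step t (M, F'(Suc t := []), R) (M @ [x], F(Suc t := []), R)"
          using move True foot_step.take_off[of "F'(Suc t := [])" t x S M R]
          by (simp add: fun_upd_twist)
        then show ?thesis
          using M move True
          by (auto intro!: exI[of _ "M @ [x]"] stack_run.push
              intro: rtranclp.rtrancl_into_rtrancl)
      next
        case False
        have "foot_step t (M, F'(Suc t := []), R) (M, F(Suc t := []), R)"
          using move False foot_step.move[of i t "F'(Suc t := [])" x S M R]
          by (simp add: fun_upd_twist)
        then show ?thesis
          using M move False by (auto intro!: exI[of _ M] intro: rtranclp.rtrancl_into_rtrancl)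
      qed
    next
      case (take_off F' x S L')
      then obtain M where "(foot_step t)\<^sup>*\<^sup>* ?init (M, F'(Suc t := []), R)"
        "stack_run M L' (F' (Suc t))"
        using step(3) by blast
      then show ?thesis
        using take_off by (auto intro!: exI[of _ M] stack_run.pop)
    qed
  qed
  from this[OF assms(2)[unfolded foot_result_def]] show ?thesis
    unfolding foot_result_def by (simp add: fun_upd_def)
qed

text \<open>The feet never look at the colors, so a run on colors can be imitated by the same operations on
  the socks that carry them.\<close>

lemma foot_result_lift:
  assumes "foot_result t (map c xs) ys"
  shows "\<exists>zs. foot_result t xs zs \<and> ys = map c zs"
proof -
  have lift_step: "\<exists>D. foot_step t C D \<and> d = map_config c D" if "foot_step t (map_config c C) d" for C d
  proof -
    obtain L F R where C: "C = (L, F, R)" by (cases C)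
    from that[unfolded C map_config.simps] show ?thesis
    proof cases
      case (put_on x R')
      then obtain y S where R: "R = y # S" "x = c y" "R' = map c S" by auto
      show ?thesis
        using put_on R foot_step.put_on[of t L F y S]
        by (intro exI[of _ "(L, F(1 := y # F 1), S)"]) (auto simp: C fun_eq_iff)
    next
      case (move i x S')
      then obtain y S where F: "F i = y # S" "x = c y" "S' = map c S" by auto
      show ?thesis
        using move F foot_step.move[of i t F y S L R]
        by (intro exI[of _ "(L, F(i := S, Suc i := y # F (Suc i)), R)"]) (auto simp: C fun_eq_iff)
    next
      case (take_off x S')
      then obtain y S where F: "F t = y # S" "x = c y" "S' = map c S" by auto
      show ?thesis
        using take_off F foot_step.take_off[of F t y S L R]
        by (intro exI[of _ "(L @ [y], F(t := S), R)"]) (auto simp: C fun_eq_iff)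
    qed
  qed
  have "\<exists>D. (foot_step t)\<^sup>*\<^sup>* C D \<and> d = map_config c D"
    if "(foot_step t)\<^sup>*\<^sup>* (map_config c C) d" for C d
    using that
  proof induction
    case base
    then show ?case by blast
  next
    case (step d d')
    then show ?case
      using lift_step by (meson rtranclp.rtrancl_into_rtrancl)
  qed
  from this[of "([], \<lambda>_. [], xs)" "(ys, \<lambda>_. [], [])"] assms
  obtain D where D: "(foot_step t)\<^sup>*\<^sup>* ([], \<lambda>_. [], xs) D" "(ys, \<lambda>_. [], []) = map_config c D"
    unfolding foot_result_def by auto
  obtain L F R where D': "D = (L, F, R)" by (cases D)
  with D(2) have "F = (\<lambda>_. [])" "R = []" "ys = map c L"
    by (auto simp: fun_eq_iff)
  with D(1) D' show ?thesis
    unfolding foot_result_def by blast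
qed

text \<open>Position of the first occurrence; it is \<open>length w\<close> if \<open>x\<close> does not occur in \<open>w\<close>.\<close>

definition pos :: "'a list \<Rightarrow> 'a \<Rightarrow> nat" where
  "pos w x = length (takeWhile (\<lambda>y. y \<noteq> x) w)"

lemma pos_simps [simp]:
  "pos (y # w) x = (if x = y then 0 else Suc (pos w x))"
  "x \<in> set u \<Longrightarrow> pos (u @ v) x = pos u x"
  "x \<notin> set u \<Longrightarrow> pos (u @ v) x = length u + pos v x"
  by (auto simp: pos_def takeWhile_append)

lemma pos_less [simp]: "x \<in> set w \<Longrightarrow> pos w x < length w"
  by (induction w) auto

lemma nth_pos [simp]: "x \<in> set w \<Longrightarrow> w ! pos w x = x"
  by (induction w) auto

text \<open>All that the lower bound uses about a stack. Let \<open>x\<close>, \<open>y\<close>, \<open>z\<close> arrive in this order.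
  When \<open>z\<close> arrives, either \<open>x\<close> has already left, or it is still in the stack; in the latter case \<open>y\<close>, having been put above \<open>x\<close>, leaves before \<open>x\<close>.
  This is the classical avoidance of the pattern 231.\<close>

definition stack_order :: "'a list \<Rightarrow> 'a list \<Rightarrow> bool" where
  "stack_order w v \<longleftrightarrow> set v = set w \<and> distinct v \<and>
    (\<forall>x \<in> set w. \<forall>y \<in> set w. \<forall>z \<in> set w. pos w x < pos w y \<longrightarrow> pos w y < pos w z \<longrightarrow>
      pos v x < pos v z \<or> pos v y < pos v x)"

text \<open>The invariant concerns \<open>L @ S\<close>, the output that would result from emptying the stack now.
  Removing an element does not change this word, and the stack itself, read from the top, is in
  reversed order of arrival.\<close>

lemma stack_run_stack_order:
  assumes "stack_run w L S" "distinct w"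
  shows "stack_order w (L @ S) \<and>
    (\<forall>x \<in> set S. \<forall>y \<in> set S. pos w x < pos w y \<longrightarrow> pos (L @ S) y < pos (L @ S) x)"
  using assms
proof induction
  case start
  then show ?case by (simp add: stack_order_def)
next
  case (push w L S x)
  then have IH: "stack_order w (L @ S)"
    "\<And>x y. x \<in> set S \<Longrightarrow> y \<in> set S \<Longrightarrow> pos w x < pos w y \<Longrightarrow> pos (L @ S) y < pos (L @ S) x"
    and x: "x \<notin> set w"
    by auto
  then have LS: "set w = set L \<union> set S" "set L \<inter> set S = {}" "distinct L" "distinct S"
    by (auto simp: stack_order_def)
  have pos_w: "pos (w @ [x]) y = (if y = x then length w else pos w y)" if "y \<in> insert x (set w)" for y
    using that x by auto
  define f where "f = pos (L @ x # S)"
  have fx: "f x = length L"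
    using x LS by (simp add: f_def)
  have fL: "f y = pos (L @ S) y" "pos (L @ S) y < length L" if "y \<in> set L" for y
    using that by (auto simp: f_def)
  have fS: "f y = Suc (pos (L @ S) y)" "length L \<le> pos (L @ S) y" if "y \<in> set S" for y
  proof -
    have "y \<notin> set L" "y \<noteq> x"
      using that x LS by auto
    then show "f y = Suc (pos (L @ S) y)" "length L \<le> pos (L @ S) y"
      using x LS(1) by (auto simp: f_def)
  qed
  have f_mono: "f y < f z" if "y \<in> set w" "z \<in> set w" "pos (L @ S) y < pos (L @ S) z" for y z
  proof -
    have "y \<in> set L \<or> y \<in> set S" "z \<in> set L \<or> z \<in> set S"
      using that LS(1) by auto
    then show ?thesis
      using that(3) fL[of y] fL[of z] fS[of y] fS[of z] by linarith
  qed
  have rev_S: "f z < f y" if "y \<in> set S" "z \<in> set S" "pos w y < pos w z" for y z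
    using f_mono[of z y] IH(2)[OF that] that LS(1) by auto
  have triple: "f a < f z \<or> f b < f a"
    if in_w: "a \<in> set w" "b \<in> set w" "z \<in> insert x (set w)"
      and lt: "pos w a < pos w b" "z \<noteq> x \<Longrightarrow> pos w b < pos w z" for a b z
  proof (cases "z = x")
    case True
    have "a \<in> set L \<or> a \<in> set S" "b \<in> set L \<or> b \<in> set S"
      using in_w LS(1) by auto
    then show ?thesis
      using lt(1) fx[folded True] fL[of a] fL[of b] fS[of a] rev_S[of a b] by linarith
  next
    case False
    then have "pos (L @ S) a < pos (L @ S) z \<or> pos (L @ S) b < pos (L @ S) a"
      using IH(1) in_w lt unfolding stack_order_def by auto
    then show ?thesis
      using f_mono in_w False by blast
  qed
  have "f a < f z \<or> f b < f a"
    if "a \<in> insert x (set w)" "b \<in> insert x (set w)" "z \<in> insert x (set w)"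
      "pos (w @ [x]) a < pos (w @ [x]) b" "pos (w @ [x]) b < pos (w @ [x]) z" for a b z
  proof -
    have "pos (w @ [x]) y \<le> length w" if "y \<in> insert x (set w)" for y
      using pos_w[OF that] that by (auto intro: less_imp_le)
    then have "a \<noteq> x" "b \<noteq> x"
      using that pos_w[of x] by (metis insertI1 not_le order.strict_trans1)+
    then show ?thesis
      using that triple[of a b z] by (auto simp: pos_w split: if_splits)
  qed
  then have "stack_order (w @ [x]) (L @ x # S)"
    using LS x unfolding stack_order_def f_def[symmetric] by auto
  moreover have "f z < f y"
    if "y \<in> set (x # S)" "z \<in> set (x # S)" "pos (w @ [x]) y < pos (w @ [x]) z" for y z
  proof -
    have "y \<in> insert x (set w)" "z \<in> insert x (set w)"
      using that LS(1) by auto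
    then have "y \<noteq> x"
      using that(3) pos_w[of y] pos_w[of z] by (auto dest: order.asym[OF pos_less] split: if_splits)
    then have "y \<in> set S" "y \<in> set w"
      using that LS(1) by auto
    then show ?thesis
      using that rev_S[of y z] fx fS[of y] \<open>y \<noteq> x\<close> \<open>z \<in> insert x (set w)\<close>
      by (cases "z = x") (auto simp: pos_w)
  qed
  ultimately show ?case
    unfolding f_def by blast
next
  case (pop w L x S)
  then show ?case by simp
qed

section \<open>Rich words\<close>

text \<open>The sock \<open>e m a\<close> represents the color \<open>a\<close> in the group number \<open>m\<close>. The order inside a group is
  left open, because a stack may permute the socks within a group.\<close>

definition rich :: "('a \<Rightarrow> 'c) \<Rightarrow> 'a list \<Rightarrow> 'c set \<Rightarrow> nat \<Rightarrow> bool" where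
  "rich c w A M \<longleftrightarrow> (\<exists>e.
    (\<forall>m < M. \<forall>a \<in> A. e m a \<in> set w \<and> c (e m a) = a) \<and>
    (\<forall>m' < M. \<forall>m < m'. \<forall>a \<in> A. \<forall>b \<in> A. pos w (e m a) < pos w (e m' b)))"

text \<open>Groups selected by the pigeonhole principle carry scattered numbers; they are renumbered in
  increasing order.\<close>

lemma rich_of_index_set:
  fixes J :: "nat set"
  assumes J: "finite J" "M \<le> card J"
    and e: "\<And>m a. m \<in> J \<Longrightarrow> a \<in> A \<Longrightarrow> e m a \<in> set w \<and> c (e m a) = a"
    and less: "\<And>m m' a b. m \<in> J \<Longrightarrow> m' \<in> J \<Longrightarrow> m < m' \<Longrightarrow> a \<in> A \<Longrightarrow> b \<in> A \<Longrightarrow>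
      pos w (e m a) < pos w (e m' b)"
  shows "rich c w A M"
proof -
  define g where "g m = sorted_list_of_set J ! m" for m
  have g: "g m \<in> J" if "m < M" for m
    using that J by (metis g_def length_sorted_list_of_set nth_mem order_less_le_trans
        set_sorted_list_of_set)
  have g_less: "g m < g m'" if "m < m'" "m' < M" for m m'
    unfolding g_def using that J
    by (intro sorted_wrt_nth_less[OF strict_sorted_list_of_set]) auto
  show ?thesis
    unfolding rich_def
  proof (intro exI[of _ "\<lambda>m. e (g m)"] conjI allI impI ballI)
    fix m a assume "m < M" "a \<in> A"
    then show "e (g m) a \<in> set w" "c (e (g m) a) = a"
      using e g by blast+
  next
    fix m' m a b assume m: "m' < M" "m < m'" and ab: "a \<in> A" "b \<in> A"
    then have "m < M" by simp
    then show "pos w (e (g m) a) < pos w (e (g m') b)"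
      using m ab g g_less less by blast
  qed
qed

text \<open>Let \<open>a\<close> be the color that comes before \<open>b\<close> in the first group. Then \<open>b\<close> of the first group lies
  between the two socks of color \<open>a\<close> from the first and the second group.\<close>

lemma rich_not_color_sorted:
  assumes "rich c w A 2" "2 \<le> card A"
  shows "\<not> color_sorted (map c w)"
proof
  assume sorted: "color_sorted (map c w)"
  obtain e where E: "\<forall>m < (2::nat). \<forall>a \<in> A. e m a \<in> set w \<and> c (e m a) = a"
    "\<forall>m' < (2::nat). \<forall>m < m'. \<forall>a \<in> A. \<forall>b \<in> A. pos w (e m a) < pos w (e m' b)"
    using assms(1) unfolding rich_def by blast
  have e: "e m a \<in> set w" "c (e m a) = a" if "m < 2" "a \<in> A" for m a
    using E(1) that by auto
  have less: "pos w (e 0 a) < pos w (e 1 b)" if "a \<in> A" "b \<in> A" for a b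
    using E(2)[rule_format, of 1 0 a b] that by simp
  have eq: "c y = c x" if "x \<in> set w" "y \<in> set w" "z \<in> set w"
    "c x = c z" "pos w x < pos w y" "pos w y < pos w z" for x y z
  proof -
    have "pos w x < pos w y \<and> pos w y < pos w z \<and> pos w z < length (map c w) \<and>
        map c w ! pos w x = map c w ! pos w z"
      using that by simp
    then have "map c w ! pos w y = map c w ! pos w x"
      using sorted unfolding color_sorted_def by blast
    then show ?thesis
      using that by simp
  qed
  obtain B where "B \<subseteq> A" "card B = 2"
    using assms(2) obtain_subset_with_card_n by metis
  then obtain a b where ab: "a \<in> A" "b \<in> A" "a \<noteq> b"
    by (auto simp: card_2_iff)
  have "pos w (e 0 a) \<noteq> pos w (e 0 b)"
    using ab e(1)[of 0 a] e(1)[of 0 b] e(2)[of 0 a] e(2)[of 0 b] by (metis nth_pos zero_less_numeral)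
  then consider "pos w (e 0 a) < pos w (e 0 b)" | "pos w (e 0 b) < pos w (e 0 a)" by linarith
  then show False
  proof cases
    case 1
    then show ?thesis
      using eq[of "e 0 a" "e 0 b" "e 1 a"] ab e less[of b a] by simp
  next
    case 2
    then show ?thesis
      using eq[of "e 0 b" "e 0 a" "e 1 b"] ab e less[of a b] by simp
  qed
qed

lemma large_fiber:
  assumes "finite S" "finite A" "\<And>s. s \<in> S \<Longrightarrow> f s \<subseteq> A" "M * 2 ^ card A \<le> card S" "0 < M"
  shows "\<exists>B. B \<in> f ` S \<and> M \<le> card {s \<in> S. f s = B}"
proof (rule ccontr)
  assume "\<not> ?thesis"
  then have small: "card {s \<in> S. f s = B} < M" if "B \<in> Pow A" for B
    using \<open>0 < M\<close> by (cases "B \<in> f ` S") (auto simp: not_le, metis (mono_tags, lifting) card.empty empty_Collect_eq imageI)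
  have "card S \<le> card (\<Union>B \<in> Pow A. {s \<in> S. f s = B})"
    using assms(1,2,3) by (intro card_mono) auto
  also have "\<dots> \<le> (\<Sum>B \<in> Pow A. card {s \<in> S. f s = B})"
    using assms(2) by (intro card_UN_le) auto
  also have "\<dots> < (\<Sum>B \<in> Pow A. M)"
    using assms(2) small by (intro sum_strict_mono) auto
  also have "\<dots> = M * 2 ^ card A"
    using assms(2) by (simp add: card_Pow)
  finally show False using assms(4) by simp
qed

section \<open>One stack keeps half of the colors rich\<close>

text \<open>Among this many groups of a rich word there are, unless the output is rich already, \<open>L\<close> groups
  that are held in the stack at a common time. The recursion mirrors the search: to find \<open>Suc L\<close>
  groups, \<open>N\<close> chunks are inspected, each consisting of one candidate group followed by a window for
  the remaining \<open>L\<close> groups.\<close>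

fun window :: "nat \<Rightarrow> nat \<Rightarrow> nat" where
  "window N 0 = 1"
| "window N (Suc L) = N * Suc (window N L)"

lemma window_pos: "0 < N \<Longrightarrow> 0 < window N L"
  by (induction L) auto

text \<open>A word \<open>w\<close>, the word \<open>v\<close> that a stack makes of it, and \<open>K\<close> groups of socks in \<open>w\<close> that witness
  its richness. The color \<open>a0\<close> is arbitrary: the sock \<open>e T a0\<close> serves as a clock marking group \<open>T\<close>.\<close>

locale stack_grid =
  fixes w v :: "'a list" and c :: "'a \<Rightarrow> 'c" and A :: "'c set" and a0 :: 'c
    and e :: "nat \<Rightarrow> 'c \<Rightarrow> 'a" and K :: nat
  assumes order: "stack_order w v"
    and finite_A: "finite A" and a0: "a0 \<in> A"
    and grid: "m < K \<Longrightarrow> a \<in> A \<Longrightarrow> e m a \<in> set w \<and> c (e m a) = a"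
    and grid_less: "m < m' \<Longrightarrow> m' < K \<Longrightarrow> a \<in> A \<Longrightarrow> b \<in> A \<Longrightarrow> pos w (e m a) < pos w (e m' b)"
begin

text \<open>The colors whose socks from group \<open>u\<close> are still in the stack when the sock \<open>e T a0\<close> arrives: for
  \<open>u < T\<close>, a sock of group \<open>u\<close> leaves after \<open>e T a0\<close> exactly if it is in the stack at that time.\<close>

definition held :: "nat \<Rightarrow> nat \<Rightarrow> 'c set" where
  "held u T = {a \<in> A. pos v (e T a0) < pos v (e u a)}"

lemma held_subset: "held u T \<subseteq> A"
  by (auto simp: held_def)

text \<open>The stack condition applied to three socks from groups \<open>u < T < u'\<close>. The three lemmas after it
  are instances in which membership in \<open>held\<close> decides between the alternatives.\<close>

lemma exit_order:
  assumes "u < T" "T < u'" "u' < K" "a \<in> A" "b \<in> A" "d \<in> A"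
  shows "pos v (e u a) < pos v (e u' d) \<or> pos v (e T b) < pos v (e u a)"
  using order assms grid[of u a] grid[of T b] grid[of u' d]
    grid_less[of u T a b] grid_less[of T u' b d]
  unfolding stack_order_def by auto

lemma held_antimono:
  assumes "u < T" "T \<le> T'" "T' < K"
  shows "held u T' \<subseteq> held u T"
proof (cases "T = T'")
  case False
  then show ?thesis
    using assms exit_order[of u T T' _ a0 a0] a0 unfolding held_def by fastforce
qed simp

lemma flushed_before:
  assumes "u < T" "T < u'" "u' < K" "a \<in> A - held u T" "b \<in> A"
  shows "pos v (e u a) < pos v (e u' b)"
  using exit_order[of u T u' a a0 b] assms a0 by (auto simp: held_def)

lemma held_reversed:
  assumes "u < u'" "u' < T" "T < K" "a \<in> held u T" "b \<in> held u' T"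
  shows "pos v (e u' b) < pos v (e u a)"
  using exit_order[of u u' T a b a0] assms a0 by (auto simp: held_def)

text \<open>The dichotomy of held and flushed colors, as an induction on the number \<open>L\<close> of simultaneously
  held groups. A color held until the end of a chunk is also held at the earlier time \<open>T\<close> that
  the search inside the chunk finds.\<close>

lemma many_held_blocks:
  assumes "0 < M" "card A \<le> k"
    and not_rich: "\<And>B. B \<subseteq> A \<Longrightarrow> card A \<le> 2 * card B \<Longrightarrow> \<not> rich c v B M"
    and "s + window (M * 2 ^ k) L \<le> K"
  shows "\<exists>T U. s \<le> T \<and> T < s + window (M * 2 ^ k) L \<and> U \<subseteq> {s..<T} \<and> card U = L \<and>
    (\<forall>u \<in> U. card A \<le> 2 * card (held u T))"
  using \<open>s + window (M * 2 ^ k) L \<le> K\<close>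
proof (induction L arbitrary: s)
  case 0
  then show ?case by (intro exI[of _ s] exI[of _ "{}"]) auto
next
  case (Suc L)
  define N where "N = M * 2 ^ k"
  define D where "D = window N L"
  \<comment> \<open>Chunk \<open>j\<close> consists of the groups \<open>b j, \<dots>, b j + D\<close>; its first group is the candidate, and the
    last one tells the time at the end of the chunk.\<close>
  define b where "b j = s + j * Suc D" for j
  have D: "0 < D"
    using \<open>0 < M\<close> by (simp add: D_def N_def window_pos)
  have b_le: "b j + Suc D \<le> b j'" if "j < j'" for j j'
  proof -
    have "Suc j * Suc D \<le> j' * Suc D"
      using that by (intro mult_le_mono1) simp
    then show ?thesis by (simp add: b_def)
  qed
  have b_N: "b N = s + window (M * 2 ^ k) (Suc L)"
    by (simp add: b_def N_def D_def)
  have b_K: "b j + D < K" if "j < N" for j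
    using b_le[OF that] b_N Suc.prems by simp
  show ?case
  proof (cases "\<exists>j < N. card A \<le> 2 * card (held (b j) (b j + D))")
    case True
    then obtain j where j: "j < N" "card A \<le> 2 * card (held (b j) (b j + D))" by blast
    \<comment> \<open>Half of the candidate stays held throughout the chunk, so the search continues inside it.\<close>
    obtain T U where TU: "Suc (b j) \<le> T" "T < Suc (b j) + D" "U \<subseteq> {Suc (b j)..<T}"
      "card U = L" "\<forall>u \<in> U. card A \<le> 2 * card (held u T)"
      using Suc.IH[of "Suc (b j)"] b_K[OF j(1)] unfolding D_def N_def by auto
    have "held (b j) (b j + D) \<subseteq> held (b j) T"
      using TU(1,2) b_K[OF j(1)] by (intro held_antimono) auto
    then have "card A \<le> 2 * card (held (b j) T)"
      using j(2) card_mono[OF finite_subset[OF held_subset finite_A], of "held (b j) (b j + D)"]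
      by (meson dual_order.trans mult_le_mono2)
    moreover have "b j \<notin> U" "finite U"
      using TU(3) finite_subset by fastforce+
    moreover have "s \<le> b j"
      by (simp add: b_def)
    moreover have "T < b N"
      using TU(2) b_le[OF j(1)] by simp
    ultimately show ?thesis
      using TU b_N by (intro exI[of _ T] exI[of _ "insert (b j) U"]) auto
  next
    case False
    \<comment> \<open>Every candidate is mostly flushed by the end of its chunk, hence before the next chunk exits.\<close>
    define F where "F j = A - held (b j) (b j + D)" for j
    have large: "card A \<le> 2 * card (F j)" if "j < N" for j
    proof -
      have "card (F j) = card A - card (held (b j) (b j + D))"
        unfolding F_def using finite_A held_subset by (meson card_Diff_subset finite_subset)
      then show ?thesis using False that by fastforce
    qed
    have "M * 2 ^ card A \<le> N"
      unfolding N_def using \<open>card A \<le> k\<close> by simp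
    then obtain B where B: "B \<in> F ` {..<N}" "M \<le> card {j \<in> {..<N}. F j = B}"
      using large_fiber[of "{..<N}" A F M] finite_A \<open>0 < M\<close> by (auto simp: F_def)
    have "rich c v B M"
    proof (rule rich_of_index_set[where J = "{j \<in> {..<N}. F j = B}" and e = "\<lambda>j. e (b j)"])
      fix j a assume "j \<in> {j \<in> {..<N}. F j = B}" "a \<in> B"
      then show "e (b j) a \<in> set v \<and> c (e (b j) a) = a"
        using grid[of "b j" a] b_K[of j] order by (auto simp: F_def stack_order_def)
    next
      fix j j' a d
      assume "j \<in> {j \<in> {..<N}. F j = B}" "j' \<in> {j \<in> {..<N}. F j = B}" "j < j'" "a \<in> B" "d \<in> B"
      then show "pos v (e (b j) a) < pos v (e (b j') d)"
        using flushed_before[of "b j" "b j + D" "b j'" a d] D b_le[of j j'] b_K[of j']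
        by (auto simp: F_def)
    qed (use B in auto)
    moreover have "B \<subseteq> A" "card A \<le> 2 * card B"
      using B(1) large by (auto simp: F_def)
    ultimately show ?thesis
      using not_rich by blast
  qed
qed

text \<open>The \<open>M * 2 ^ k\<close> simultaneously held groups contain \<open>M\<close> groups that agree on the held colors.\<close>

lemma half_rich_after_pass:
  assumes "0 < M" "card A \<le> k" "window (M * 2 ^ k) (M * 2 ^ k) \<le> K"
  shows "\<exists>B \<subseteq> A. card A \<le> 2 * card B \<and> rich c v B M"
proof (rule ccontr)
  assume not_rich: "\<not> ?thesis"
  define N where "N = M * 2 ^ k"
  obtain T U where TU: "T < window N N" "U \<subseteq> {..<T}" "card U = N"
    "\<And>u. u \<in> U \<Longrightarrow> card A \<le> 2 * card (held u T)"
    using many_held_blocks[OF assms(1,2), of 0 N] not_rich assms(3)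
    by (auto simp: N_def atLeast0LessThan)
  have "finite U"
    using TU(2) finite_subset by blast
  moreover have "M * 2 ^ card A \<le> card U"
    using \<open>card A \<le> k\<close> TU(3) by (simp add: N_def)
  ultimately obtain B where B: "B \<in> (\<lambda>u. held u T) ` U" "M \<le> card {u \<in> U. held u T = B}"
    using large_fiber[of U A "\<lambda>u. held u T" M] finite_A held_subset \<open>0 < M\<close> by blast
  let ?U = "{u \<in> U. held u T = B}"
  have T: "T < K"
    using TU(1) assms(3) by (simp add: N_def)
  have U_T: "u < T" if "u \<in> U" for u
    using that TU(2) by auto
  have "rich c v B M"
  \<comment> \<open>The stack reverses the held groups, so they are numbered backwards from \<open>T\<close>.\<close>
  proof (rule rich_of_index_set[where J = "(\<lambda>u. T - u) ` ?U" and e = "\<lambda>m. e (T - m)"])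
    have "inj_on (\<lambda>u. T - u) ?U"
      using U_T by (intro inj_onI) (auto dest!: U_T)
    then show "M \<le> card ((\<lambda>u. T - u) ` ?U)"
      using B(2) by (simp add: card_image)
  next
    fix m a assume "m \<in> (\<lambda>u. T - u) ` ?U" "a \<in> B"
    then show "e (T - m) a \<in> set v \<and> c (e (T - m) a) = a"
      using grid[of "T - m" a] T held_subset order by (fastforce simp: stack_order_def)
  next
    fix m m' a d
    assume m: "m \<in> (\<lambda>u. T - u) ` ?U" "m' \<in> (\<lambda>u. T - u) ` ?U" "m < m'" and ad: "a \<in> B" "d \<in> B"
    obtain u u' where u: "m = T - u" "m' = T - u'" "u \<in> ?U" "u' \<in> ?U"
      using m by auto
    then have "u' < u" "u < T" "T - m = u" "T - m' = u'"
      using m(3) U_T[of u] U_T[of u'] by auto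
    then show "pos v (e (T - m) a) < pos v (e (T - m') d)"
      using held_reversed[of u' u T d a] T u ad by auto
  qed (use \<open>finite U\<close> in auto)
  moreover have "B \<subseteq> A" "card A \<le> 2 * card B"
    using B(1) TU(4) held_subset by auto
  ultimately show False
    using not_rich by blast
qed

end

lemma stack_order_half_rich:
  assumes "stack_order w v" "finite A" "card A \<le> k" "0 < M"
    and "rich c w A (window (M * 2 ^ k) (M * 2 ^ k))"
  shows "\<exists>B \<subseteq> A. card A \<le> 2 * card B \<and> rich c v B M"
proof (cases "A = {}")
  case True
  then show ?thesis by (auto simp: rich_def)
next
  case False
  then obtain a0 where "a0 \<in> A" by blast
  obtain e where e:
    "\<forall>m < window (M * 2 ^ k) (M * 2 ^ k). \<forall>a \<in> A. e m a \<in> set w \<and> c (e m a) = a"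
    "\<forall>m' < window (M * 2 ^ k) (M * 2 ^ k). \<forall>m < m'. \<forall>a \<in> A. \<forall>b \<in> A.
      pos w (e m a) < pos w (e m' b)"
    using assms(5) unfolding rich_def by blast
  have "stack_grid w v c A a0 e (window (M * 2 ^ k) (M * 2 ^ k))"
    by unfold_locales (use assms(1,2) \<open>a0 \<in> A\<close> e in auto)
  from stack_grid.half_rich_after_pass[OF this assms(4,3) order.refl] show ?thesis .
qed

text \<open>The required richness is computed from the last pass backwards. All intermediate color sets are
  subsets of \<open>A\<close>, so \<open>card A\<close> is a uniform bound for their sizes.\<close>

lemma stack_run_iterate_rich:
  assumes "finite A" "0 < M"
  shows "\<exists>D. \<forall>w v. ((\<lambda>w v. stack_run w v []) ^^ t) w v \<longrightarrow> distinct w \<longrightarrow> rich c w A D \<longrightarrow>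
    distinct v \<and> (\<exists>B \<subseteq> A. card A \<le> 2 ^ t * card B \<and> rich c v B M)"
  using \<open>0 < M\<close>
proof (induction t arbitrary: M)
  case 0
  then show ?case by auto
next
  case (Suc t)
  define M' where "M' = window (M * 2 ^ card A) (M * 2 ^ card A)"
  have "0 < M'"
    using Suc.prems by (simp add: M'_def window_pos)
  then obtain D where D: "\<And>w u. ((\<lambda>w v. stack_run w v []) ^^ t) w u \<Longrightarrow> distinct w \<Longrightarrow>
      rich c w A D \<Longrightarrow> distinct u \<and> (\<exists>B \<subseteq> A. card A \<le> 2 ^ t * card B \<and> rich c u B M')"
    using Suc.IH by blast
  show ?case
  proof (intro exI[of _ D] allI impI)
    fix w v
    assume "((\<lambda>w v. stack_run w v []) ^^ Suc t) w v" and w: "distinct w" "rich c w A D"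
    then obtain u where u: "((\<lambda>w v. stack_run w v []) ^^ t) w u" "stack_run u v []"
      by auto
    obtain B where B: "distinct u" "B \<subseteq> A" "card A \<le> 2 ^ t * card B" "rich c u B M'"
      using D[OF u(1) w] by blast
    have uv: "stack_order u v"
      using stack_run_stack_order[OF u(2) B(1)] by simp
    have "finite B" "card B \<le> card A"
      using B(2) \<open>finite A\<close> by (auto intro: finite_subset card_mono)
    then obtain C where C: "C \<subseteq> B" "card B \<le> 2 * card C" "rich c v C M"
      using stack_order_half_rich[OF uv _ _ Suc.prems B(4)[unfolded M'_def]] by blast
    have "card A \<le> 2 ^ t * (2 * card C)"
      using B(3) C(2) by (meson dual_order.trans mult_le_mono2)
    then show "distinct v \<and> (\<exists>B \<subseteq> A. card A \<le> 2 ^ Suc t * card B \<and> rich c v B M)"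
      using uv B(2) C by (auto simp: stack_order_def mult.assoc intro!: exI[of _ C])
  qed
qed

lemma foot_result_stack_runs:
  assumes "1 \<le> t" "foot_result t xs ys"
  shows "((\<lambda>w v. stack_run w v []) ^^ t) xs ys"
  using assms
proof (induction t arbitrary: ys rule: nat_induct_at_least)
  case base
  then show ?case using foot_result_1_stack_run by (auto simp: relcompp_apply)
next
  case (Suc t)
  obtain zs where "foot_result t xs zs" "stack_run zs ys []"
    using foot_result_Suc_stack_run[OF Suc.hyps(1) Suc.prems] by blast
  then show ?case
    using Suc.IH by (auto simp: relcompp_apply)
qed

section \<open>The sorting threshold\<close>

text \<open>The word repeats \<open>0, \<dots>, n - 1\<close> sufficiently often; the sock at position \<open>i\<close> is identified by \<open>i\<close>
  and has color \<open>i mod n\<close>.\<close>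

lemma exists_unsortable_word:
  assumes "2 ^ t < n"
  shows "\<exists>xs. card (set xs) = n \<and> \<not> word_sortable (int t) xs"
proof -
  obtain D where D: "\<forall>w v. ((\<lambda>w v. stack_run w v []) ^^ t) w v \<longrightarrow> distinct w \<longrightarrow>
      rich (\<lambda>i. i mod n) w {..<n} D \<longrightarrow> distinct v \<and>
      (\<exists>B \<subseteq> {..<n}. card {..<n} \<le> 2 ^ t * card B \<and> rich (\<lambda>i. i mod n) v B 2)"
    using stack_run_iterate_rich[of "{..<n}" 2 t "\<lambda>i. i mod n", OF finite_lessThan zero_less_numeral]
    by (rule exE)
  \<comment> \<open>One repetition more than richness asks for, so that all colors appear even if \<open>D = 0\<close>.\<close>
  define ids where "ids = [0..<Suc D * n]"
  define xs where "xs = map (\<lambda>i. i mod n) ids"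
  have in_ids: "m * n + a \<in> set ids" if "m \<le> D" "a < n" for m a
  proof -
    have "m * n + a < Suc m * n"
      using that by simp
    also have "\<dots> \<le> Suc D * n"
      using that by (intro mult_le_mono1) simp
    finally show ?thesis by (simp add: ids_def)
  qed
  have pos_ids: "pos ids i = i" if "i \<in> set ids" for i
  proof -
    have "ids ! pos ids i = pos ids i"
      using pos_less[OF that] unfolding ids_def by (simp del: pos_less)
    then show ?thesis
      using nth_pos[OF that] by simp
  qed
  have "rich (\<lambda>i. i mod n) ids {..<n} D"
    unfolding rich_def
  proof (intro exI[of _ "\<lambda>m a. m * n + a"] conjI allI impI ballI)
    fix m' m a b assume m: "m' < D" "m < m'" and ab: "a \<in> {..<n}" "b \<in> {..<n}"
    have "m * n + a < Suc m * n"
      using ab by simp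
    also have "\<dots> \<le> m' * n"
      using m by (intro mult_le_mono1) simp
    finally have "m * n + a < m' * n + b" by simp
    then show "pos ids (m * n + a) < pos ids (m' * n + b)"
      using m ab pos_ids in_ids by simp
  qed (use in_ids in auto)
  then have unsorted: "\<not> color_sorted (map (\<lambda>i. i mod n) v)"
    if runs: "((\<lambda>w v. stack_run w v []) ^^ t) ids v" for v
  proof -
    obtain B where B: "n \<le> 2 ^ t * card B" "rich (\<lambda>i. i mod n) v B 2"
      using D[rule_format, OF runs _ \<open>rich _ ids _ _\<close>] by (auto simp: ids_def)
    have "2 \<le> card B"
    proof (rule ccontr)
      assume "\<not> 2 \<le> card B"
      then have "2 ^ t * card B \<le> 2 ^ t * 1" by (intro mult_le_mono2) simp
      then show False using B(1) assms by linarith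
    qed
    with B(2) show ?thesis by (rule rich_not_color_sorted)
  qed
  have "\<not> word_sortable (int t) xs"
  proof (cases "t = 0")
    case True
    then show ?thesis
      using unsorted[of ids] by (simp add: word_sortable_def xs_def)
  next
    case False
    show ?thesis
    proof
      assume "word_sortable (int t) xs"
      then obtain ys where "foot_result t xs ys" "color_sorted ys"
        using False by (auto simp: word_sortable_def)
      moreover from this obtain v where "foot_result t ids v" "ys = map (\<lambda>i. i mod n) v"
        using foot_result_lift unfolding xs_def by blast
      ultimately show False
        using unsorted foot_result_stack_runs[of t ids v] False by simp
    qed
  qed
  moreover have "set xs = {..<n}"
  proof
    show "set xs \<subseteq> {..<n}"
      using assms by (auto simp: xs_def)
    show "{..<n} \<subseteq> set xs"
      using in_ids[of 0] by (force simp: xs_def)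
  qed
  ultimately show ?thesis by (intro exI[of _ xs]) simp
qed

lemma ceiling_log_2_cases:
  assumes "1 \<le> n"
  obtains (one) "n = 1" "\<lceil>log 2 (real n)\<rceil> = 0"
  | (more) t where "\<lceil>log 2 (real n)\<rceil> = int t + 1" "2 ^ t < n" "n \<le> 2 ^ Suc t"
proof (cases "n = 1")
  case True
  then show ?thesis using one by simp
next
  case False
  then have log_pos: "0 < log 2 (real n)"
    using assms by simp
  define t where "t = nat (\<lceil>log 2 (real n)\<rceil> - 1)"
  have t: "\<lceil>log 2 (real n)\<rceil> = int t + 1"
    using log_pos by (simp add: t_def)
  then have "real t < log 2 (real n)" "log 2 (real n) \<le> real (Suc t)"
    by linarith+
  then have "2 powr real t < real n" "real n \<le> 2 powr real (Suc t)"
    using assms by (simp_all add: less_log_iff log_le_iff del: of_nat_Suc)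
  then have "real (2 ^ t) < real n" "real n \<le> real (2 ^ Suc t)"
    by (simp_all add: powr_realpow del: of_nat_Suc)
  then show ?thesis
    using more[OF t] unfolding of_nat_less_iff of_nat_le_iff by blast
qed

theorem theorem1p3:
  fixes n :: nat
  assumes "n \<ge> 1"
  shows "(\<forall>s. num_colors s = n \<longrightarrow> foot_sortable \<lceil>log 2 (real n)\<rceil> s) \<and>
         (\<exists>s. num_colors s = n \<and> \<not> foot_sortable (\<lceil>log 2 (real n)\<rceil> - 1) s)"
proof -
  have upper: "foot_sortable k s"
    if "\<And>xs. card (set xs) = n \<Longrightarrow> word_sortable k xs" "num_colors s = n" for k s
    using that by transfer
  have lower: "\<exists>s. num_colors s = n \<and> \<not> foot_sortable k s"
    if "card (set xs) = n" "\<not> word_sortable k xs" for k xs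
    using that by transfer blast
  from assms show ?thesis
  proof (cases rule: ceiling_log_2_cases)
    case one
    have "word_sortable 0 xs" if card_xs: "card (set xs) = n" for xs
    proof -
      obtain a where a: "set xs = {a}"
        using card_xs one(1) by (auto simp: card_1_singleton_iff)
      have "xs ! i = a" if "i < length xs" for i
        using a nth_mem[OF that] by simp
      then show ?thesis
        by (simp add: word_sortable_def color_sorted_def)
    qed
    moreover have "\<not> word_sortable (-1) [0]"
      by (simp add: word_sortable_def)
    ultimately show ?thesis
      using one(2) upper[of 0] lower[of "[0]" "-1"] one(1) by simp
  next
    case (more t)
    have "word_sortable (int t + 1) xs" if "card (set xs) = n" for xs
      using foot_sort_few_colors[of "Suc t" xs] that more(3)
      by (simp add: word_sortable_def nat_add_distrib)
    then have "\<forall>s. num_colors s = n \<longrightarrow> foot_sortable (int t + 1) s"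
      using upper by blast
    moreover have "\<exists>s. num_colors s = n \<and> \<not> foot_sortable (int t) s"
      using exists_unsortable_word[OF more(2)] lower by blast
    ultimately show ?thesis
      using more(1) by simp
  qed
qed

end
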